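(* Let $\lambda$ be a nonzero real number. For all integers $n\ge k\ge 0$, $$G_{\lambda}(n+1,k)=G_{\lambda}(n,k-1)-(n+k\lambda)G_{\lambda}(n,k).$$
   Context: For $\lambda\in\mathbb{R}$, $\lambda\neq 0$: $\langle x\rangle_{0,\lambda}=1$, $\langle x\rangle_{n,\lambda}=x(x+\lambda)\cdots(x+(n-1)\lambda)$ for $n\ge 1$. The falling factorial is $(x)_0=1$, $(x)_n=x(x-1)\cdots(x-n+1)$ for $n\ge 1$. The heterogeneous Stirling numbers of the first kind $G_\lambda(n,k)$ are defined by the polynomial identity $(x)_{n}=\sum_{k=0}^{n}G_{\lambda}(n,k)\langle x\rangle_{k,\lambda}$ for $n\ge 0$, with $G_\lambda(n,k)=0$ for $k<0$ or $n<k$. *)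

theory Defs
  imports "HOL-Computational_Algebra.Polynomial"
begin

text \<open>
  The factorials are taken as elements of the polynomial ring over the reals:
  \<open>[:a, 1:]\<close> is the linear polynomial \<open>x + a\<close>.
\<close>

definition falling_fact_poly :: "nat \<Rightarrow> real poly" where
  "falling_fact_poly n = (\<Prod>i<n. [:- real i, 1:])"

definition rising_fact_poly :: "real \<Rightarrow> nat \<Rightarrow> real poly" where
  "rising_fact_poly lam n = (\<Prod>i<n. [:real i * lam, 1:])"

text \<open>
  The second index ranges over the integers, because the convention
  \<open>G(n, k) = 0\<close> for \<open>k < 0\<close> is part of the definition.
\<close>

definition is_het_stirling1_row :: "real \<Rightarrow> nat \<Rightarrow> (int \<Rightarrow> real) \<Rightarrow> bool" where
  "is_het_stirling1_row lam n g \<longleftrightarrow>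
     falling_fact_poly n = (\<Sum>k=0..n. smult (g (int k)) (rising_fact_poly lam k)) \<and>
     (\<forall>k. k < 0 \<or> int n < k \<longrightarrow> g k = 0)"

definition het_stirling1 :: "real \<Rightarrow> nat \<Rightarrow> int \<Rightarrow> real" where
  "het_stirling1 lam n = (THE g. is_het_stirling1_row lam n g)"

text \<open>
  The definite description is justified below: the rising factorials are monic
  with \<open>degree (rising_fact_poly lam k) = k\<close>, so the coefficients exist and are unique.
\<close>

lemma rising_fact_poly_degree_monic:
  "degree (rising_fact_poly lam n) = n \<and> lead_coeff (rising_fact_poly lam n) = 1"
proof (induction n)
  case 0
  show ?case by (simp add: rising_fact_poly_def)
next
  case (Suc n)
  have eq: "rising_fact_poly lam (Suc n) = rising_fact_poly lam n * [:real n * lam, 1:]"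
    by (simp add: rising_fact_poly_def)
  have "rising_fact_poly lam n \<noteq> 0" using Suc by auto
  then have "degree (rising_fact_poly lam (Suc n)) = Suc n"
    unfolding eq using Suc by (simp add: degree_mult_eq del: mult_pCons_right)
  moreover have "lead_coeff (rising_fact_poly lam (Suc n)) = 1"
  proof -
    have "lead_coeff [:real n * lam, 1:] = 1" by simp
    moreover have "lead_coeff (rising_fact_poly lam n) = 1" using Suc by blast
    ultimately show ?thesis unfolding eq lead_coeff_mult by (simp only: mult_1)
  qed
  ultimately show ?case by simp
qed

lemma falling_fact_poly_degree: "degree (falling_fact_poly n) \<le> n"
proof (induction n)
  case 0
  show ?case by (simp add: falling_fact_poly_def)
next
  case (Suc n)
  have "falling_fact_poly (Suc n) = falling_fact_poly n * [:- real n, 1:]"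
    by (simp add: falling_fact_poly_def)
  moreover have "degree (falling_fact_poly n * [:- real n, 1:]) \<le> degree (falling_fact_poly n) + 1"
    by (rule order_trans[OF degree_mult_le]) simp
  ultimately show ?case using Suc by simp
qed

lemma rising_fact_poly_span:
  "degree p \<le> n \<Longrightarrow> \<exists>c. p = (\<Sum>k=0..n. smult (c k) (rising_fact_poly lam k))"
proof (induction n arbitrary: p)
  case 0
  then have "degree p = 0" by simp
  then obtain a where "p = [:a:]" by (rule degree_eq_zeroE)
  then show ?case by (intro exI[of _ "\<lambda>_. a"]) (simp add: rising_fact_poly_def)
next
  case (Suc n)
  let ?r = "rising_fact_poly lam (Suc n)"
  let ?q = "p - smult (coeff p (Suc n)) ?r"
  have r: "degree ?r = Suc n" "coeff ?r (Suc n) = 1"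
    using rising_fact_poly_degree_monic[of lam "Suc n"] by auto
  have "coeff ?q i = 0" if "i > n" for i
  proof (cases "i = Suc n")
    case True
    then show ?thesis using r by simp
  next
    case False
    then have "i > Suc n" using that by simp
    then have "coeff p i = 0" "coeff ?r i = 0" using r Suc.prems by (auto intro: coeff_eq_0)
    then show ?thesis by simp
  qed
  then have "degree ?q \<le> n" by (intro degree_le allI impI)
  from Suc.IH[OF this] obtain c
    where c: "?q = (\<Sum>k=0..n. smult (c k) (rising_fact_poly lam k))" by blast
  let ?c = "c(Suc n := coeff p (Suc n))"
  have "(\<Sum>k=0..Suc n. smult (?c k) (rising_fact_poly lam k)) =
        (\<Sum>k=0..n. smult (c k) (rising_fact_poly lam k)) + smult (coeff p (Suc n)) ?r"
    by simp
  also have "\<dots> = p" by (simp flip: c)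
  finally show ?case by (intro exI[of _ ?c]) (rule sym)
qed

lemma rising_fact_poly_indep:
  "(\<Sum>k=0..n. smult (c k) (rising_fact_poly lam k)) = 0 \<Longrightarrow> k \<le> n \<Longrightarrow> c k = 0"
proof (induction n)
  case 0
  then show ?case by (simp add: rising_fact_poly_def)
next
  case (Suc n)
  have r: "degree (rising_fact_poly lam j) = j" "coeff (rising_fact_poly lam j) j = 1" for j
    using rising_fact_poly_degree_monic[of lam j] by auto
  have "coeff (\<Sum>k=0..n. smult (c k) (rising_fact_poly lam k)) (Suc n) = 0"
    unfolding coeff_sum by (intro sum.neutral) (auto simp: coeff_eq_0 r(1))
  moreover have "coeff (\<Sum>k=0..Suc n. smult (c k) (rising_fact_poly lam k)) (Suc n) = 0"
    unfolding Suc.prems(1) by simp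
  ultimately have "c (Suc n) = 0" by (simp add: r(2))
  then show ?case using Suc by (cases "k = Suc n") auto
qed

lemma ex1_het_stirling1_row: "\<exists>!g. is_het_stirling1_row lam n g"
proof (rule ex_ex1I)
  obtain c where "falling_fact_poly n = (\<Sum>k=0..n. smult (c k) (rising_fact_poly lam k))"
    using rising_fact_poly_span[OF falling_fact_poly_degree] by blast
  then have "is_het_stirling1_row lam n (\<lambda>k. if k < 0 \<or> int n < k then 0 else c (nat k))"
    by (simp add: is_het_stirling1_row_def)
  then show "\<exists>g. is_het_stirling1_row lam n g" by blast
next
  fix g h
  assume g: "is_het_stirling1_row lam n g" and h: "is_het_stirling1_row lam n h"
  have "(\<Sum>k=0..n. smult (g (int k) - h (int k)) (rising_fact_poly lam k)) = 0"
    using g h by (simp add: is_het_stirling1_row_def smult_diff_left sum_subtractf)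
  then have eq: "g (int k) = h (int k)" if "k \<le> n" for k
    using rising_fact_poly_indep[where c = "\<lambda>k. g (int k) - h (int k)"] that by simp
  show "g = h"
  proof
    fix k :: int
    show "g k = h k"
    proof (cases "k < 0 \<or> int n < k")
      case True
      then show ?thesis using g h by (auto simp: is_het_stirling1_row_def)
    next
      case False
      then have "nat k \<le> n" "int (nat k) = k" by auto
      then show ?thesis using eq[of "nat k"] by metis
    qed
  qed
qed

end

theory Submission
  imports Defs
begin

text \<open>Multiply the expansion of the falling factorial of order n by x - n. In the k-th term
  write x - n = (x + k lam) - (n + k lam): the first part raises the rising factorial to order k +
  1, the second only rescales it (\<open>linear_mult_rising_fact_poly\<close>). Collecting
  coefficients gives an expansion of order n + 1 (\<open>is_het_stirling1_row_Suc\<close>), and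
  uniqueness of such expansions (\<open>het_stirling1_eqI\<close>) identifies its
  coefficients.\<close>

lemma is_het_stirling1_row_het_stirling1: "is_het_stirling1_row lam n (het_stirling1 lam n)"
  unfolding het_stirling1_def by (rule theI'[OF ex1_het_stirling1_row])

lemma het_stirling1_eqI: "is_het_stirling1_row lam n g \<Longrightarrow> het_stirling1 lam n = g"
  using ex1_het_stirling1_row is_het_stirling1_row_het_stirling1 by blast

lemma falling_fact_poly_Suc: "falling_fact_poly (Suc n) = [:- real n, 1:] * falling_fact_poly n"
  by (simp add: falling_fact_poly_def mult.commute del: mult_pCons_left mult_pCons_right)

lemma linear_mult_rising_fact_poly:
  "[:- real n, 1:] * rising_fact_poly lam k =
     rising_fact_poly lam (Suc k) - smult (real n + real k * lam) (rising_fact_poly lam k)"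
proof -
  \<comment> \<open>The split depends on k: x + k lam is the next factor of the rising
    factorial.\<close>
  have "[:- real n, 1:] = [:real k * lam, 1:] - [:real n + real k * lam:]" by simp
  then have "[:- real n, 1:] * rising_fact_poly lam k =
      [:real k * lam, 1:] * rising_fact_poly lam k
        - [:real n + real k * lam:] * rising_fact_poly lam k"
    by (simp only: left_diff_distrib)
  moreover have "rising_fact_poly lam (Suc k) = [:real k * lam, 1:] * rising_fact_poly lam k"
    by (simp add: rising_fact_poly_def mult.commute del: mult_pCons_left mult_pCons_right)
  ultimately show ?thesis by simp
qed

text \<open>The recurrence is treated as a map on whole integer-indexed rows, because uniqueness
  determines a row as a function.\<close>

lemma is_het_stirling1_row_Suc:
  assumes "is_het_stirling1_row lam n g"
  shows "is_het_stirling1_row lam (Suc n) (\<lambda>j. g (j - 1) - (real n + of_int j * lam) * g j)"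
proof -
  let ?R = "rising_fact_poly lam"
  let ?a = "\<lambda>k. real n + real k * lam"
  have g: "falling_fact_poly n = (\<Sum>k=0..n. smult (g (int k)) (?R k))"
    and out: "\<And>k. k < 0 \<or> int n < k \<Longrightarrow> g k = 0"
    using assms by (auto simp: is_het_stirling1_row_def)
  \<comment> \<open>The extra term at k = 0 has coefficient \<open>g (-1)\<close>, which is
    0.\<close>
  have shift: "(\<Sum>k=0..Suc n. smult (g (int k - 1)) (?R k)) =
      (\<Sum>k=0..n. smult (g (int k)) (?R (Suc k)))"
    by (subst sum.atLeast0_atMost_Suc_shift) (simp add: out)
  have "falling_fact_poly (Suc n) = (\<Sum>k=0..n. smult (g (int k)) ([:- real n, 1:] * ?R k))"
    unfolding falling_fact_poly_Suc g sum_distrib_left by (simp only: mult_smult_right)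
  also have "\<dots> = (\<Sum>k=0..n. smult (g (int k)) (?R (Suc k))) -
      (\<Sum>k=0..n. smult (?a k * g (int k)) (?R k))"
    unfolding linear_mult_rising_fact_poly
    by (simp add: smult_diff_right sum_subtractf mult.commute)
  \<comment> \<open>The added top term vanishes since g is 0 at n + 1; both sums now have the same
    range.\<close>
  also have "(\<Sum>k=0..n. smult (?a k * g (int k)) (?R k)) =
      (\<Sum>k=0..Suc n. smult (?a k * g (int k)) (?R k))"
    by (simp add: out)
  finally have "falling_fact_poly (Suc n) =
      (\<Sum>k=0..Suc n. smult (g (int k - 1) - ?a k * g (int k)) (?R k))"
    by (simp only: shift[symmetric] smult_diff_left sum_subtractf)
  \<comment> \<open>For j < 0 or j > n + 1, both j - 1 and j lie outside 0..n, so the new row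
    vanishes there.\<close>
  then show ?thesis by (simp add: is_het_stirling1_row_def out)
qed

theorem theorem2p7:
  fixes lam :: real and n k :: nat
  assumes "lam \<noteq> 0" and "k \<le> n"
  shows "het_stirling1 lam (n + 1) (int k) =
           het_stirling1 lam n (int k - 1) - (real n + real k * lam) * het_stirling1 lam n (int k)"
  using het_stirling1_eqI[OF is_het_stirling1_row_Suc[OF is_het_stirling1_row_het_stirling1]]
  by simp

end
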